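(* Let $Y=\delta_0\theta+A\gamma+\varepsilon$ be the position-bias model of the context, with $\theta\in\mathbb{R}^{V}$, $\gamma\in\mathbb{R}^{\mathcal{A}}$ fixed (unknown) and the entries of $\varepsilon\in\mathbb{R}^{E}$ i.i.d. $N(0,\sigma^2)$. Assume $|E|\ge 2|\mathcal{A}|+|V|$. Let $\tilde A$ be knockoff features for $A$, and let $W=(W_j)_{j\in\mathcal{A}}$ be the knockoff statistics computed from $(\delta_0,A,\tilde A,Y)$ using any one of the three solution paths ISS, LBI, or LASSO. Let $q\in[0,1]$. (i) If $\hat S=\{j: W_j\ge T_0\}$ is the set selected by the knockoff filter at level $q$, then $$\mathbb{E}\left[\frac{\#\{j:\gamma_j=0 \text{ and } j\in\hat S\}}{\#\{j: j\in\hat S\}+q^{-1}}\right]\le q .$$ (ii) If $\hat S=\{j: W_j\ge T_1\}$ is the set selected by the knockoff+ filter at level $q$, then $$\mathbb{E}\left[\frac{\#\{j:\gamma_j=0 \text{ and } j\in\hat S\}}{\#\{j: j\in\hat S\}}\right]\le q .$$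
   Context: **Model.** $V=\{1,\dots,n\}$ is a finite set of items, $\mathcal{A}$ a finite set of annotators, and $E$ a finite set of triples $(\alpha,i,j)$ with $\alpha\in\mathcal{A}$, $i,j\in V$ (pairwise comparisons); all are deterministic. Define the linear maps $\delta_0:\mathbb{R}^{V}\to\mathbb{R}^{E}$, $(\delta_0\theta)(\alpha,i,j)=\theta_i-\theta_j$, and $A:\mathbb{R}^{\mathcal{A}}\to\mathbb{R}^{E}$, $(A\gamma)(\alpha,i,j)=\gamma^\alpha$ (also written $\gamma_\alpha$), identified with their matrices. The observed data are $Y=\delta_0\theta+A\gamma+\varepsilon\in\mathbb{R}^{E}$. **Knockoff features.** A deterministic matrix $\tilde A\in\mathbb{R}^{E\times\mathcal{A}}$ (depending on $\delta_0,A$ but not on $Y$) is a matrix of knockoff features for $A$ if, for some vector $s\in\mathbb{R}^{\mathcal{A}}$ with positive entries, $$\tilde A^T\tilde A=A^TA,\qquad A^T\tilde A=A^TA-\mathrm{diag}(s),\qquad \delta_0^T\tilde A=\delta_0^TA .$$ (The construction used: with $H=\delta_0(\delta_0^T\delta_0)^\dagger\delta_0^T$, where $\dagger$ denotes the pseudo-inverse, take $s$ maximizing $\sum_j s_j$ subject to $0\le s_j\le1$ and $\mathrm{diag}(s)\preceq 2A^T(I-H)A$; take $Q\in\mathbb{R}^{|E|\times|\mathcal{A}|}$ with orthonormal columns, $\delta_0^TQ=0$, $A^TQ=0$; and set $\tilde A=A-(I-H)A(A^T(I-H)A)^{-1}\mathrm{diag}(s)+QC$ where $C^TC=2\,\mathrm{diag}(s)-\mathrm{diag}(s)(A^T(I-H)A)^{-1}\mathrm{diag}(s)$.)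 **Solution paths.** Put $A_{ko}=[A,\tilde A]\in\mathbb{R}^{|E|\times 2|\mathcal{A}|}$ and $\gamma_{ko}=(\gamma,\tilde\gamma)\in\mathbb{R}^{2|\mathcal{A}|}$. - LASSO: for $\lambda>0$, $\hat\gamma_{ko}(\lambda)$ is the $\gamma_{ko}$-component of a minimizer over $(\theta,\gamma_{ko})$ of $\frac12\|Y-\delta_0\theta-A_{ko}\gamma_{ko}\|_2^2+\lambda\|\gamma_{ko}\|_1$. - ISS (Inverse Scale Space): $\hat\gamma_{ko}(t)$, $t\ge0$, is the $\gamma_{ko}$-component of the solution, started from $p(0)=0$, $\gamma_{ko}(0)=0$ (with $p$ continuous and $\gamma_{ko}$ right-continuous in $t$), of $$\frac{dp}{dt}=A_{ko}^T(Y-\delta_0\theta-A_{ko}\gamma_{ko}),\quad 0=\delta_0^T(Y-\delta_0\theta-A_{ko}\gamma_{ko}),\quad p\in\partial\|\gamma_{ko}\|_1 .$$ - LBI (Linearized Bregman Iteration): fix $\kappa>0$, $\Delta t>0$ and a stopping time $t_{stop}$, all independent of the data. Start from $w^0=0$, $\gamma_{ko}^0=0$, $\theta^0=(\delta_0^T\delta_0)^\dagger\delta_0^TY$ and iterate $w^{k+1}=w^k+A_{ko}^T(Y-\delta_0\theta^k-A_{ko}\gamma_{ko}^k)\Delta t$, $\gamma_{ko}^{k+1}=\kappa\,\mathrm{shrink}(w^{k+1})$, $\theta^{k+1}=\theta^k+\kappa\delta_0^T(Y-\delta_0\theta^k-A_{ko}\gamma_{ko}^k)\Delta t$, with $\mathrm{shrink}(x)=\mathrm{sign}(x)\max\{|x|-1,0\}$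 applied componentwise, stopping when $k\Delta t>t_{stop}$; the path is $\hat\gamma_{ko}(k\Delta t)=\gamma_{ko}^k$. **Knockoff statistics.** For $j\in\mathcal{A}$ let $Z_j$ be $\sup\{\lambda>0:\hat\gamma_j(\lambda)\ne0\}$ for LASSO, or $\sup\{1/t: t>0,\ \hat\gamma_j(t)\neq0\}$ for ISS/LBI, where $\hat\gamma_j$ is the coordinate of $\hat\gamma_{ko}$ for the column $A_j$; $\tilde Z_j$ is defined in the same way from the coordinate for the column $\tilde A_j$. The supremum of the empty set is $0$. If a path is not uniquely determined, "$\hat\gamma_j\ne0$" means that this holds for at least one solution. Then $$W_j=\max(Z_j,\tilde Z_j)\,\mathrm{sign}(Z_j-\tilde Z_j),\qquad \mathrm{sign}(0)=0 .$$ **Thresholds.** For $a\in\{0,1\}$, $$T_a=\min\left\{t\in\{|W_j|:j\in\mathcal{A}\}\setminus\{0\}:\ \frac{a+\#\{j:W_j\le-t\}}{\max(\#\{j:W_j\ge t\},1)}\le q\right\},$$ with $T_a=+\infty$ if the set is empty. $T_0$ is the knockoff threshold and $T_1$ the knockoff+ threshold. **Conventions.** $0/0=0$, and for $q=0$ one reads $q^{-1}=+\infty$ (so the fraction in (i) is $0$). *)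

theory Defs
  imports "HOL-Probability.Probability"
begin

section \<open>The position-bias model\<close>

text \<open>
  Items and annotators are the elements of finite types \<open>'v\<close> and \<open>'a\<close>. The finite set of
  comparisons is indexed by a finite type \<open>'e\<close> through an injective map
  \<open>cmp :: 'e \<Rightarrow> 'a \<times> 'v \<times> 'v\<close>, so that the index type is in bijection with the set \<open>range cmp\<close> of
  triples, and vectors over the comparisons have type \<open>real ^ 'e\<close>.
\<close>

definition delta0 :: "('e \<Rightarrow> 'a \<times> 'v \<times> 'v) \<Rightarrow> real ^ 'v::finite ^ 'e::finite" where
  "delta0 cmp = matrix (\<lambda>\<theta> :: real ^ 'v. \<chi> e. case cmp e of (\<alpha>, i, j) \<Rightarrow> \<theta> $ i - \<theta> $ j)"

definition annot :: "('e \<Rightarrow> 'a \<times> 'v \<times> 'v) \<Rightarrow> real ^ 'a::finite ^ 'e::finite" where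
  "annot cmp = matrix (\<lambda>\<gamma> :: real ^ 'a. \<chi> e. case cmp e of (\<alpha>, i, j) \<Rightarrow> \<gamma> $ \<alpha>)"

lemma delta0_mult_vec:
  "delta0 cmp *v \<theta> = (\<chi> e. case cmp e of (\<alpha>, i, j) \<Rightarrow> \<theta> $ i - \<theta> $ j)"
  unfolding delta0_def
  by (rule matrix_works)
     (auto intro!: Vector_Spaces.linear.intro module_hom.intro module_hom_axioms.intro vec.module_axioms vec.vector_space_axioms simp: vec_eq_iff algebra_simps split: prod.splits)

lemma annot_mult_vec:
  "annot cmp *v \<gamma> = (\<chi> e. case cmp e of (\<alpha>, i, j) \<Rightarrow> \<gamma> $ \<alpha>)"
  unfolding annot_def
  by (rule matrix_works)
     (auto intro!: Vector_Spaces.linear.intro module_hom.intro module_hom_axioms.intro vec.module_axioms vec.vector_space_axioms simp: vec_eq_iff split: prod.splits)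


section \<open>Knockoff features\<close>

definition diag_mat :: "real ^ 'a \<Rightarrow> real ^ 'a ^ 'a" where
  "diag_mat s = (\<chi> i j. if i = j then s $ i else 0)"

definition knockoff_features ::
    "real ^ 'v ^ 'e \<Rightarrow> real ^ 'a ^ 'e \<Rightarrow> real ^ 'a ^ 'e \<Rightarrow> bool" where
  "knockoff_features D A At \<longleftrightarrow>
     (\<exists>s. (\<forall>j. s $ j > 0) \<and>
          transpose At ** At = transpose A ** A \<and>
          transpose A ** At = transpose A ** A - diag_mat s \<and>
          transpose D ** At = transpose D ** A)"

text \<open>The columns of \<open>[A, At]\<close> are indexed by the disjoint sum \<open>'a + 'a\<close>.\<close>

definition augment :: "real ^ 'a ^ 'e \<Rightarrow> real ^ 'a ^ 'e \<Rightarrow> real ^ ('a + 'a) ^ 'e" where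
  "augment A At = (\<chi> e k. case k of Inl j \<Rightarrow> A $ e $ j | Inr j \<Rightarrow> At $ e $ j)"


section \<open>Solution paths\<close>

text \<open>
  Throughout, \<open>D\<close> is the design matrix of the unpenalized part \<open>\<theta>\<close>, \<open>X\<close> that of the penalized
  part \<open>g\<close>, and \<open>y\<close> is the data vector.
\<close>

definition l1norm :: "real ^ 'k::finite \<Rightarrow> real" where
  "l1norm g = (\<Sum>k\<in>UNIV. \<bar>g $ k\<bar>)"

definition subdifferential :: "('b::real_inner \<Rightarrow> real) \<Rightarrow> 'b \<Rightarrow> 'b set" where
  "subdifferential f x = {p. \<forall>z. f z \<ge> f x + p \<bullet> (z - x)}"

text \<open>The Moore--Penrose inverse.\<close>

definition pinv :: "real ^ 'n ^ 'm \<Rightarrow> real ^ 'm ^ 'n" where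
  "pinv M = (THE P. M ** P ** M = M \<and> P ** M ** P = P \<and>
                    transpose (M ** P) = M ** P \<and> transpose (P ** M) = P ** M)"

definition residual ::
    "real ^ 'v ^ 'e \<Rightarrow> real ^ 'k ^ 'e \<Rightarrow> real ^ 'e \<Rightarrow> real ^ 'v \<Rightarrow> real ^ 'k \<Rightarrow> real ^ 'e" where
  "residual D X y \<theta> g = y - D *v \<theta> - X *v g"

definition lasso_solution ::
    "real ^ 'v ^ 'e \<Rightarrow> real ^ 'k ^ 'e \<Rightarrow> real ^ 'e \<Rightarrow> real \<Rightarrow> real ^ 'v \<Rightarrow> real ^ 'k \<Rightarrow> bool" where
  "lasso_solution D X y l \<theta> g \<longleftrightarrow>
     is_arg_min (\<lambda>(\<theta>, g). 1/2 * (norm (residual D X y \<theta> g))\<^sup>2 + l * l1norm g)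
       (\<lambda>_. True) (\<theta>, g)"

text \<open>
  The penalized component of an ISS solution is only right-continuous and may jump, and \<open>p\<close>
  then has a kink. The derivative of \<open>p\<close> is therefore the right derivative; as the right-hand
  side is right-continuous, this amounts to the integrated form of the equation.
\<close>

definition iss_solution ::
    "real ^ 'v ^ 'e \<Rightarrow> real ^ 'k ^ 'e \<Rightarrow> real ^ 'e \<Rightarrow>
     (real \<Rightarrow> real ^ 'k) \<Rightarrow> (real \<Rightarrow> real ^ 'v) \<Rightarrow> (real \<Rightarrow> real ^ 'k) \<Rightarrow> bool" where
  "iss_solution D X y p \<theta> g \<longleftrightarrow>
     p 0 = 0 \<and> g 0 = 0 \<and>
     continuous_on {0..} p \<and>
     (\<forall>t\<ge>0. continuous (at_right t) g) \<and>
     (\<forall>t\<ge>0. (p has_vector_derivative transpose X *v residual D X y (\<theta> t) (g t)) (at_right t)) \<and>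
     (\<forall>t\<ge>0. transpose D *v residual D X y (\<theta> t) (g t) = 0) \<and>
     (\<forall>t\<ge>0. p t \<in> subdifferential l1norm (g t))"

definition shrink :: "real ^ 'k \<Rightarrow> real ^ 'k" where
  "shrink w = (\<chi> k. sgn (w $ k) * max (\<bar>w $ k\<bar> - 1) 0)"

text \<open>The state of the linearized Bregman iteration is the triple \<open>(w, \<theta>, g)\<close>.\<close>

primrec lbi_state ::
    "real ^ 'v ^ 'e \<Rightarrow> real ^ 'k ^ 'e \<Rightarrow> real ^ 'e \<Rightarrow> real \<Rightarrow> real \<Rightarrow> nat \<Rightarrow>
     (real ^ 'k) \<times> (real ^ 'v) \<times> (real ^ 'k)" where
  "lbi_state D X y \<kappa> dt 0 = (0, pinv (transpose D ** D) *v (transpose D *v y), 0)"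
| "lbi_state D X y \<kappa> dt (Suc n) =
     (let (w, \<theta>, g) = lbi_state D X y \<kappa> dt n;
          r = residual D X y \<theta> g;
          w' = w + dt *\<^sub>R (transpose X *v r)
      in (w', \<theta> + (\<kappa> * dt) *\<^sub>R (transpose D *v r), \<kappa> *\<^sub>R shrink w'))"

definition lbi_path ::
    "real ^ 'v ^ 'e \<Rightarrow> real ^ 'k ^ 'e \<Rightarrow> real ^ 'e \<Rightarrow> real \<Rightarrow> real \<Rightarrow> nat \<Rightarrow> real ^ 'k" where
  "lbi_path D X y \<kappa> dt n = snd (snd (lbi_state D X y \<kappa> dt n))"


section \<open>Knockoff statistics\<close>

text \<open>\<open>LBI \<kappa> dt tstop\<close> carries the damping factor, the step size and the stopping time.\<close>

datatype path_method = ISS | LBI real real real | LASSO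

fun valid_method :: "path_method \<Rightarrow> bool" where
  "valid_method (LBI \<kappa> dt tstop) \<longleftrightarrow> \<kappa> > 0 \<and> dt > 0"
| "valid_method ISS \<longleftrightarrow> True"
| "valid_method LASSO \<longleftrightarrow> True"

text \<open>
  The set whose supremum is the statistic of column \<open>k\<close>. Solutions need not be unique, hence
  the existential quantifiers over solutions for ISS and LASSO.
\<close>

fun entry_set ::
    "path_method \<Rightarrow> real ^ 'v ^ 'e \<Rightarrow> real ^ 'k::finite ^ 'e \<Rightarrow> real ^ 'e \<Rightarrow> 'k \<Rightarrow> real set" where
  "entry_set LASSO D X y k = {l. l > 0 \<and> (\<exists>\<theta> g. lasso_solution D X y l \<theta> g \<and> g $ k \<noteq> 0)}"
| "entry_set ISS D X y k =
     {1 / t | t. t > 0 \<and> (\<exists>p \<theta> g. iss_solution D X y p \<theta> g \<and> g t $ k \<noteq> 0)}"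
| "entry_set (LBI \<kappa> dt tstop) D X y k =
     {1 / t | t. t > 0 \<and> (\<exists>n. t = real n * dt \<and> t \<le> tstop \<and> lbi_path D X y \<kappa> dt n $ k \<noteq> 0)}"

text \<open>The supremum of the empty set is unspecified for type \<open>real\<close>.\<close>

definition Z_stat ::
    "path_method \<Rightarrow> real ^ 'v ^ 'e \<Rightarrow> real ^ 'k::finite ^ 'e \<Rightarrow> real ^ 'e \<Rightarrow> 'k \<Rightarrow> real" where
  "Z_stat m D X y k = (if entry_set m D X y k = {} then 0 else Sup (entry_set m D X y k))"

definition W_stat ::
    "path_method \<Rightarrow> real ^ 'v ^ 'e \<Rightarrow> real ^ 'a::finite ^ 'e \<Rightarrow> real ^ 'a ^ 'e \<Rightarrow> real ^ 'e \<Rightarrow>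
     'a \<Rightarrow> real" where
  "W_stat m D A At y j =
     (let Z = Z_stat m D (augment A At) y (Inl j);
          Zt = Z_stat m D (augment A At) y (Inr j)
      in max Z Zt * sgn (Z - Zt))"


section \<open>The knockoff filter\<close>

definition threshold_candidates :: "nat \<Rightarrow> real \<Rightarrow> ('a::finite \<Rightarrow> real) \<Rightarrow> real set" where
  "threshold_candidates a q W =
     {t \<in> range (\<lambda>j. \<bar>W j\<bar>) - {0}.
        (real a + real (card {j. W j \<le> - t})) / real (max (card {j. W j \<ge> t}) 1) \<le> q}"

text \<open>Knockoff is the case \<open>a = 0\<close>, knockoff+ the case \<open>a = 1\<close>.\<close>

definition knockoff_threshold :: "nat \<Rightarrow> real \<Rightarrow> ('a::finite \<Rightarrow> real) \<Rightarrow> ereal" where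
  "knockoff_threshold a q W =
     (if threshold_candidates a q W = {} then \<infinity> else ereal (Min (threshold_candidates a q W)))"

definition knockoff_selected :: "nat \<Rightarrow> real \<Rightarrow> ('a::finite \<Rightarrow> real) \<Rightarrow> 'a set" where
  "knockoff_selected a q W = {j. ereal (W j) \<ge> knockoff_threshold a q W}"

text \<open>
  The two ratios take values in \<open>ennreal\<close>, where \<open>0 / 0 = 0\<close>, \<open>inverse 0 = \<infinity>\<close> and \<open>x / \<infinity> = 0\<close> for
  finite \<open>x\<close>; so \<open>mfdp\<close> vanishes for \<open>q = 0\<close>. \<open>H\<close> is the set of true nulls, \<open>S\<close> the selected set.
\<close>

definition mfdp :: "real \<Rightarrow> 'a set \<Rightarrow> 'a set \<Rightarrow> ennreal" where
  "mfdp q H S = of_nat (card (H \<inter> S)) / (of_nat (card S) + inverse (ennreal q))"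

definition fdp :: "'a set \<Rightarrow> 'a set \<Rightarrow> ennreal" where
  "fdp H S = of_nat (card (H \<inter> S)) / of_nat (card S)"

lemma mfdp_0: "mfdp 0 H S = 0"
  by (simp add: mfdp_def ennreal_divide_top)

lemma fdp_empty: "fdp H {} = 0"
  by (simp add: fdp_def)

end

theory Submission
  imports Defs
begin

text \<open>
  Let \<open>v\<^sub>j\<close> be the difference of the \<open>j\<close>-th columns of \<open>A\<close> and \<open>At\<close>. The Gram conditions
  imply that the Householder reflection along \<open>v\<^sub>j\<close> exchanges these two columns and fixes
  all the other columns and the range of \<open>D\<close>. All three solution paths are equivariant under
  isometries, so reflecting the data flips the sign of \<open>W\<^sub>j\<close> and changes no other statistic, for
  every \<open>y\<close>. For a null \<open>j\<close> the reflection fixes the mean of \<open>Y\<close> and hence preserves its law.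
  The expectation is therefore at most the expectation of the average over all sign flips of the
  null statistics, and that average is bounded pointwise. The bound is a leave-one-out argument:
  let \<open>T\<^sub>j\<close> be the threshold with \<open>W\<^sub>j\<close> replaced by \<open>\<bar>W\<^sub>j\<bar>\<close>. Flipping the sign of \<open>W\<^sub>j\<close> in the
  \<open>j\<close>-th summand of \<open>V\<^sup>+ / (1 + V\<^sup>-)\<close> turns the sum into one of terms \<open>1 / #{k. W\<^sub>k \<le> - T\<^sub>j}\<close>
  over the \<open>j\<close> with \<open>W\<^sub>j \<le> - T\<^sub>j\<close>, and all such \<open>j\<close> have the same \<open>T\<^sub>j\<close>.
\<close>

section \<open>Isometries and Gaussian vectors\<close>

lemma nn_integral_lborel_translate:
  fixes f :: "'b::euclidean_space \<Rightarrow> ennreal"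
  assumes [measurable]: "f \<in> borel_measurable borel"
  shows "(\<integral>\<^sup>+x. f (a + x) \<partial>lborel) = (\<integral>\<^sup>+x. f x \<partial>lborel)"
proof -
  have "(\<integral>\<^sup>+x. f (a + x) \<partial>lborel) = (\<integral>\<^sup>+x. f x \<partial>distr lborel borel ((+) a))"
    by (subst nn_integral_distr) auto
  then show ?thesis
    by (simp add: lborel_distr_plus)
qed

text \<open>
  The library has the invariance of Lebesgue measure under orthogonal maps only for well-ordered
  index types. This is the uniqueness proof for Haar measure: the image measure is translation
  invariant and gives the unit ball the same mass.
\<close>

lemma nn_integral_lborel_isometry:
  fixes R :: "'b::euclidean_space \<Rightarrow> 'b" and g :: "'b \<Rightarrow> ennreal"
  assumes lin: "linear R" and inv: "\<And>x. R (R x) = x" and nrm: "\<And>x. norm (R x) = norm x"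
    and [measurable]: "g \<in> borel_measurable borel"
  shows "(\<integral>\<^sup>+x. g (R x) \<partial>lborel) = (\<integral>\<^sup>+x. g x \<partial>lborel)"
proof -
  define f :: "'b \<Rightarrow> ennreal" where "f = indicator (ball 0 1)"
  define c where "c = (\<integral>\<^sup>+x. f x \<partial>lborel)"
  have [measurable]: "R \<in> borel_measurable borel"
    using lin by (simp add: borel_measurable_continuous_onI linear_continuous_on linear_conv_bounded_linear)
  have [measurable]: "f \<in> borel_measurable borel"
    unfolding f_def by (intro borel_measurable_indicator) auto
  have fR: "f (R x) = f x" and fm: "f (- x) = f x" for x
    by (simp_all add: f_def indicator_def nrm)
  have "c * (\<integral>\<^sup>+y. g y \<partial>lborel) = (\<integral>\<^sup>+x. f (R x) * (\<integral>\<^sup>+y. g y \<partial>lborel) \<partial>lborel)"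
    by (simp add: c_def fR nn_integral_multc)
  also have "\<dots> = (\<integral>\<^sup>+x. f (R x) * (\<integral>\<^sup>+y. g (R x + y) \<partial>lborel) \<partial>lborel)"
    by (subst nn_integral_lborel_translate[where f = g]) simp_all
  also have "\<dots> = (\<integral>\<^sup>+x. \<integral>\<^sup>+y. f (R x) * g (R x + y) \<partial>lborel \<partial>lborel)"
    by (simp add: nn_integral_cmult)
  also have "\<dots> = (\<integral>\<^sup>+y. \<integral>\<^sup>+x. f (R x) * g (R x + y) \<partial>lborel \<partial>lborel)"
    by (rule lborel_pair.Fubini') measurable
  also have "\<dots> = (\<integral>\<^sup>+y. \<integral>\<^sup>+x. f (R x - y) * g (R x) \<partial>lborel \<partial>lborel)"
  proof (rule nn_integral_cong)
    \<comment> \<open>The shift by \<open>R y\<close> gives \<open>R (R y + x) = y + R x\<close>,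
      because \<open>R\<close> is a linear involution. The translation thus moves from the argument
      of \<open>g\<close> to that of \<open>f\<close>.\<close>
    fix y
    have "(\<integral>\<^sup>+x. f (R x - y) * g (R x) \<partial>lborel) =
          (\<integral>\<^sup>+x. f (R (R y + x) - y) * g (R (R y + x)) \<partial>lborel)"
      by (rule nn_integral_lborel_translate[symmetric]) measurable
    then show "(\<integral>\<^sup>+x. f (R x) * g (R x + y) \<partial>lborel) = (\<integral>\<^sup>+x. f (R x - y) * g (R x) \<partial>lborel)"
      by (simp add: linear_add[OF lin] inv add.commute)
  qed
  also have "\<dots> = (\<integral>\<^sup>+x. \<integral>\<^sup>+y. f (R x - y) * g (R x) \<partial>lborel \<partial>lborel)"
    by (rule lborel_pair.Fubini') measurable
  also have "\<dots> = (\<integral>\<^sup>+x. c * g (R x) \<partial>lborel)"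
  proof (rule nn_integral_cong)
    fix x
    have "(\<integral>\<^sup>+y. f (R x - y) \<partial>lborel) = (\<integral>\<^sup>+y. f (R x - (R x + y)) \<partial>lborel)"
      by (rule nn_integral_lborel_translate[symmetric]) measurable
    then show "(\<integral>\<^sup>+y. f (R x - y) * g (R x) \<partial>lborel) = c * g (R x)"
      by (simp add: nn_integral_multc fm c_def)
  qed
  also have "\<dots> = c * (\<integral>\<^sup>+x. g (R x) \<partial>lborel)"
    by (simp add: nn_integral_cmult)
  finally have eq: "c * (\<integral>\<^sup>+y. g y \<partial>lborel) = c * (\<integral>\<^sup>+x. g (R x) \<partial>lborel)" .
  have "c = emeasure lborel (ball (0::'b) 1)"
    by (simp add: c_def f_def)
  moreover have "emeasure lborel (ball (0::'b) 1) \<noteq> 0"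
    using content_ball_pos[of 1 "0::'b"] by (auto simp: measure_def)
  ultimately have "c \<noteq> 0" "c \<noteq> \<top>"
    using emeasure_lborel_ball_finite[of "0::'b" 1] by auto
  with eq show ?thesis
    by (simp add: ennreal_mult_cancel_left)
qed

text \<open>Lebesgue measure is determined by its values on boxes, and the preimage of a box is a
  product of intervals. This carries product measures, in which independence is expressed, over to
  the space on which the reflections act.\<close>

lemma distr_vec_PiM_lborel:
  "distr (PiM UNIV (\<lambda>_::'e::finite. lborel)) borel (\<lambda>x. \<chi> e. x e) = (lborel :: (real ^ 'e) measure)"
proof (rule lborel_eqI[symmetric])
  interpret product_sigma_finite "\<lambda>_::'e. lborel :: real measure" ..
  have vec [measurable]: "(\<lambda>x. \<chi> e. x e) \<in> borel_measurable (PiM UNIV (\<lambda>_::'e. lborel :: real measure))"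
    by (subst borel_measurable_euclidean_space) (auto simp: Basis_vec_def inner_axis)
  fix l u :: "real ^ 'e"
  assume lu: "\<And>b. b \<in> Basis \<Longrightarrow> l \<bullet> b \<le> u \<bullet> b"
  then have lu': "l $ e \<le> u $ e" for e
    using lu[of "axis e 1"] by (simp add: inner_axis axis_in_Basis_iff)
  have "(\<lambda>x. \<chi> e. x e) -` box l u \<inter> space (PiM UNIV (\<lambda>_::'e. lborel :: real measure))
     = PiE UNIV (\<lambda>e. {l $ e <..< u $ e})"
    by (auto simp: mem_box_cart space_PiM PiE_iff)
  then have "emeasure (distr (PiM UNIV (\<lambda>_::'e. lborel)) borel (\<lambda>x. \<chi> e. x e)) (box l u)
      = ennreal (\<Prod>e\<in>UNIV. u $ e - l $ e)"
    by (simp add: emeasure_distr emeasure_PiM lu' prod_ennreal)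
  also have "(\<Prod>e\<in>UNIV. u $ e - l $ e) = (\<Prod>b\<in>Basis. (u - l) \<bullet> b)"
  proof -
    have B: "Basis = (\<lambda>e::'e. axis e (1::real)) ` UNIV"
      by (auto simp: Basis_vec_def)
    show ?thesis
      unfolding B by (subst prod.reindex) (auto simp: inj_on_def axis_eq_axis inner_axis)
  qed
  finally show "emeasure (distr (PiM UNIV (\<lambda>_::'e. lborel)) borel (\<lambda>x. \<chi> e. x e)) (box l u)
      = (\<Prod>b\<in>Basis. (u - l) \<bullet> b)" .
qed simp

text \<open>A product measure is determined by measurable rectangles, and over a rectangle the
  integral of a product of one-variable functions factorizes.\<close>

lemma PiM_density:
  fixes f :: "'i \<Rightarrow> 'b \<Rightarrow> ennreal"
  assumes fin: "finite I" and N: "sigma_finite_measure N"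
    and [measurable]: "\<And>i. f i \<in> borel_measurable N"
    and sf: "\<And>i. sigma_finite_measure (density N (f i))"
  shows "PiM I (\<lambda>i. density N (f i)) = density (PiM I (\<lambda>_. N)) (\<lambda>x. \<Prod>i\<in>I. f i (x i))"
proof -
  interpret N: sigma_finite_measure N by fact
  interpret P: product_sigma_finite "\<lambda>_::'i. N" ..
  interpret Q: product_sigma_finite "\<lambda>i::'i. density N (f i)"
    by (intro product_sigma_finite.intro sf)
  have m [measurable]: "(\<lambda>x. \<Prod>i\<in>I. f i (x i)) \<in> borel_measurable (PiM I (\<lambda>_. N))"
    using fin by measurable
  show ?thesis
  proof (rule Q.PiM_eqI[OF fin, symmetric])
    show "sets (density (PiM I (\<lambda>_. N)) (\<lambda>x. \<Prod>i\<in>I. f i (x i))) = sets (PiM I (\<lambda>i. density N (f i)))"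
      by (simp cong: sets_PiM_cong)
    fix A assume "\<And>i. i \<in> I \<Longrightarrow> A i \<in> sets (density N (f i))"
    then have A [measurable]: "\<And>i. i \<in> I \<Longrightarrow> A i \<in> sets N"
      by simp
    have AI: "PiE I A \<in> sets (PiM I (\<lambda>_. N))"
      using fin A by (rule sets_PiM_I_finite)
    have "emeasure (density (PiM I (\<lambda>_. N)) (\<lambda>x. \<Prod>i\<in>I. f i (x i))) (PiE I A)
        = (\<integral>\<^sup>+x. (\<Prod>i\<in>I. f i (x i)) * indicator (PiE I A) x \<partial>PiM I (\<lambda>_. N))"
      using m AI by (rule emeasure_density)
    also have "\<dots> = (\<integral>\<^sup>+x. (\<Prod>i\<in>I. f i (x i) * indicator (A i) (x i)) \<partial>PiM I (\<lambda>_. N))"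
    proof (intro nn_integral_cong)
      fix x assume x: "x \<in> space (PiM I (\<lambda>_. N))"
      have "indicator (PiE I A) x = (\<Prod>i\<in>I. indicator (A i) (x i) :: ennreal)"
        using x fin by (auto simp: indicator_def space_PiM PiE_iff)
      then show "(\<Prod>i\<in>I. f i (x i)) * indicator (PiE I A) x = (\<Prod>i\<in>I. f i (x i) * indicator (A i) (x i))"
        by (simp add: prod.distrib)
    qed
    also have "\<dots> = (\<Prod>i\<in>I. \<integral>\<^sup>+x. f i x * indicator (A i) x \<partial>N)"
      using fin by (rule P.product_nn_integral_prod) simp
    also have "\<dots> = (\<Prod>i\<in>I. emeasure (density N (f i)) (A i))"
      by (intro prod.cong refl emeasure_density[symmetric]) auto
    finally show "emeasure (density (PiM I (\<lambda>_. N)) (\<lambda>x. \<Prod>i\<in>I. f i (x i))) (PiE I A) = \<dots>" .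
  qed
qed

text \<open>Independence turns the joint law into a product of normal laws;
  \<open>PiM_density\<close> pulls the densities out, and \<open>distr_vec_PiM_lborel\<close>
  identifies the base measure.\<close>

lemma distr_gaussian_vec:
  fixes \<epsilon> :: "'e::finite \<Rightarrow> 'w \<Rightarrow> real"
  assumes "prob_space M" and \<sigma>: "\<sigma> > 0"
    and ind: "prob_space.indep_vars M (\<lambda>_. borel) \<epsilon> UNIV"
    and dst: "\<And>e. distributed M lborel (\<epsilon> e) (\<lambda>x. ennreal (normal_density 0 \<sigma> x))"
  shows "distr M borel (\<lambda>\<omega>. \<chi> e. \<epsilon> e \<omega>) =
    density lborel (\<lambda>x. \<Prod>e\<in>UNIV. ennreal (normal_density 0 \<sigma> (x $ e)))"
proof -
  interpret prob_space M by fact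
  have rv [measurable]: "\<epsilon> e \<in> borel_measurable M" for e
    using dst[of e] by (auto simp: distributed_def)
  have law: "distr M borel (\<epsilon> e) = density lborel (\<lambda>x. ennreal (normal_density 0 \<sigma> x))" for e
    using distributed_distr_eq_density[OF dst[of e]] by (simp cong: distr_cong)
  let ?n = "\<lambda>x. ennreal (normal_density 0 \<sigma> x)"
  let ?P = "PiM UNIV (\<lambda>_::'e. borel :: real measure)"
  let ?vec = "\<lambda>x::'e \<Rightarrow> real. \<chi> e. x e"
  have vec [measurable]: "?vec \<in> borel_measurable ?P"
    by (subst borel_measurable_euclidean_space) (auto simp: Basis_vec_def inner_axis)
  have dens [measurable]: "(\<lambda>x::real^'e. \<Prod>e\<in>UNIV. ?n (x $ e)) \<in> borel_measurable borel"
    by measurable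
  have "distr M borel (\<lambda>\<omega>. \<chi> e. \<epsilon> e \<omega>) = distr (distr M ?P (\<lambda>\<omega>. \<lambda>e\<in>UNIV. \<epsilon> e \<omega>)) borel ?vec"
  proof -
    have X: "(\<lambda>\<omega>. \<lambda>e\<in>UNIV. \<epsilon> e \<omega>) \<in> measurable M ?P"
      by (intro measurable_restrict) simp
    have "?vec \<circ> (\<lambda>\<omega>. \<lambda>e\<in>UNIV. \<epsilon> e \<omega>) = (\<lambda>\<omega>. \<chi> e. \<epsilon> e \<omega>)"
      by (simp add: fun_eq_iff vec_eq_iff)
    then show ?thesis
      using distr_distr[OF vec X] by (simp only:)
  qed
  also have "distr M ?P (\<lambda>\<omega>. \<lambda>e\<in>UNIV. \<epsilon> e \<omega>) = PiM UNIV (\<lambda>e. density lborel ?n)"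
    using ind by (subst (asm) indep_vars_iff_distr_eq_PiM) (auto simp: law)
  also have "\<dots> = density (PiM UNIV (\<lambda>_. lborel)) (\<lambda>x. \<Prod>e\<in>UNIV. ?n (x e))"
    using prob_space_normal_density[OF \<sigma>, of 0]
    by (intro PiM_density) (auto intro: lborel.sigma_finite_measure_axioms prob_space_imp_sigma_finite)
  also have "distr \<dots> borel ?vec = density (distr (PiM UNIV (\<lambda>_. lborel)) borel ?vec) (\<lambda>x. \<Prod>e\<in>UNIV. ?n (x $ e))"
    by (subst density_distr) (auto cong: measurable_cong_sets sets_PiM_cong)
  finally show ?thesis
    by (simp add: distr_vec_PiM_lborel)
qed

text \<open>Shows that the density depends on \<open>x\<close> only through its norm, so every
  norm-preserving map leaves it unchanged.\<close>

lemma gaussian_vec_density_eq: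
  fixes x :: "real ^ 'e"
  shows "(\<Prod>e\<in>UNIV. normal_density 0 \<sigma> (x $ e)) =
    (1 / sqrt (2 * pi * \<sigma>\<^sup>2)) ^ CARD('e) * exp (- (norm x)\<^sup>2 / (2 * \<sigma>\<^sup>2))"
proof -
  have "(norm x)\<^sup>2 = (\<Sum>e\<in>UNIV. (x $ e)\<^sup>2)"
    unfolding power2_norm_eq_inner inner_vec_def by (simp add: power2_eq_square)
  then have "exp (- (norm x)\<^sup>2 / (2 * \<sigma>\<^sup>2)) = (\<Prod>e\<in>UNIV. exp (- (x $ e)\<^sup>2 / (2 * \<sigma>\<^sup>2)))"
    by (simp add: sum_negf sum_divide_distrib flip: exp_sum)
  then show ?thesis
    by (simp add: normal_density_def prod_dividef power_one_over)
qed

lemma distr_density_isometry: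
  fixes R :: "'b::euclidean_space \<Rightarrow> 'b"
  assumes "linear R" "\<And>x. R (R x) = x" "\<And>x. norm (R x) = norm x"
    and [measurable]: "f \<in> borel_measurable borel" and f: "\<And>x. f (R x) = f x"
  shows "distr (density lborel f) borel R = density lborel f"
proof (rule measure_eqI)
  have [measurable]: "R \<in> borel_measurable borel"
    using assms(1) by (simp add: borel_measurable_continuous_onI linear_continuous_on linear_conv_bounded_linear)
  fix A assume "A \<in> sets (distr (density lborel f) borel R)"
  then have [measurable]: "A \<in> sets borel" by simp
  have "emeasure (distr (density lborel f) borel R) A = (\<integral>\<^sup>+x. f (R x) * indicator A (R x) \<partial>lborel)"
    by (simp add: emeasure_distr emeasure_density f indicator_def vimage_def cong: if_cong)
  also have "\<dots> = (\<integral>\<^sup>+x. f x * indicator A x \<partial>lborel)"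
    by (rule nn_integral_lborel_isometry) (use assms in auto)
  finally show "emeasure (distr (density lborel f) borel R) A = emeasure (density lborel f) A"
    by (simp add: emeasure_density)
qed simp

text \<open>\<open>R\<close> preserves the law of the noise and, being linear with
  \<open>R \<mu> = \<mu>\<close>, commutes with the translation by \<open>\<mu>\<close>.\<close>

lemma distr_gaussian_isometry:
  fixes \<epsilon> :: "'e::finite \<Rightarrow> 'w \<Rightarrow> real" and R :: "real ^ 'e \<Rightarrow> real ^ 'e"
  assumes M: "prob_space M" and \<sigma>: "\<sigma> > 0"
    and ind: "prob_space.indep_vars M (\<lambda>_. borel) \<epsilon> UNIV"
    and dst: "\<And>e. distributed M lborel (\<epsilon> e) (\<lambda>x. ennreal (normal_density 0 \<sigma> x))"
    and Y: "\<And>\<omega>. Y \<omega> = \<mu> + (\<chi> e. \<epsilon> e \<omega>)"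
    and R: "linear R" "\<And>x. R (R x) = x" "\<And>x. norm (R x) = norm x" and \<mu>: "R \<mu> = \<mu>"
  shows "distr (distr M borel Y) borel R = distr M borel Y"
proof -
  interpret prob_space M by fact
  let ?v = "\<lambda>\<omega>. (\<chi> e. \<epsilon> e \<omega>) :: real ^ 'e"
  let ?d = "\<lambda>x::real^'e. \<Prod>e\<in>UNIV. ennreal (normal_density 0 \<sigma> (x $ e))"
  have [measurable]: "R \<in> borel_measurable borel"
    using R(1) by (simp add: borel_measurable_continuous_onI linear_continuous_on linear_conv_bounded_linear)
  have rv [measurable]: "\<epsilon> e \<in> borel_measurable M" for e
    using dst[of e] by (auto simp: distributed_def)
  have v [measurable]: "?v \<in> borel_measurable M"
    by (subst borel_measurable_euclidean_space) (auto simp: Basis_vec_def inner_axis)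
  have "?d (R x) = ?d x" for x
    by (simp add: prod_ennreal gaussian_vec_density_eq R(3))
  then have inv: "distr (distr M borel ?v) borel R = distr M borel ?v"
    unfolding distr_gaussian_vec[OF M \<sigma> ind dst] by (intro distr_density_isometry R) auto
  have Yd: "distr M borel Y = distr (distr M borel ?v) borel ((+) \<mu>)"
    by (subst distr_distr) (auto simp: comp_def Y cong: distr_cong)
  have "distr (distr M borel Y) borel R = distr (distr (distr M borel ?v) borel R) borel ((+) \<mu>)"
    unfolding Yd by (simp add: distr_distr comp_def linear_add[OF R(1)] \<mu>)
  then show ?thesis
    unfolding inv Yd .
qed

section \<open>Lower integrals\<close>

text \<open>
  The integrands of the theorem are not known to be measurable. The integral of such a function
  is the supremum over simple functions below it, which is still superadditive.
\<close>

lemma nn_integral_le_of_distr_eq: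
  assumes R: "R \<in> measurable N N" and inv: "distr N N R = N"
  shows "(\<integral>\<^sup>+x. f x \<partial>N) \<le> (\<integral>\<^sup>+x. f (R x) \<partial>N)"
  unfolding nn_integral_def[of N f]
proof (rule SUP_least, clarsimp)
  fix g assume g: "simple_function N g" "g \<le> f"
  have "integral\<^sup>S N g = (\<integral>\<^sup>+x. g x \<partial>N)"
    using g by (simp add: nn_integral_eq_simple_integral)
  also have "\<dots> = (\<integral>\<^sup>+x. g x \<partial>distr N N R)"
    by (simp add: inv)
  also have "\<dots> = (\<integral>\<^sup>+x. g (R x) \<partial>N)"
    using g R by (intro nn_integral_distr) (auto intro: borel_measurable_simple_function)
  also have "\<dots> \<le> (\<integral>\<^sup>+x. f (R x) \<partial>N)"
    using g by (intro nn_integral_mono) (auto simp: le_fun_def)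
  finally show "integral\<^sup>S N g \<le> (\<integral>\<^sup>+x. f (R x) \<partial>N)" .
qed

text \<open>The sum of simple functions below \<open>f\<close> and below \<open>g\<close> is a
  simple function below their sum. This direction lets the integrals over the sign patterns be
  collected under one integral.\<close>

lemma nn_integral_superadditive:
  "(\<integral>\<^sup>+x. f x \<partial>N) + (\<integral>\<^sup>+x. g x \<partial>N) \<le> (\<integral>\<^sup>+x. f x + g x \<partial>N)"
proof -
  let ?S = "\<lambda>f. {u. simple_function N u \<and> u \<le> f}"
  have ne: "?S h \<noteq> {}" for h :: "'a \<Rightarrow> ennreal"
    by (auto intro!: exI[of _ "\<lambda>_. 0"] simp: le_fun_def)
  have *: "integral\<^sup>S N u + integral\<^sup>S N v \<le> (\<integral>\<^sup>+x. f x + g x \<partial>N)" if "u \<in> ?S f" "v \<in> ?S g" for u v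
  proof -
    have "integral\<^sup>S N u + integral\<^sup>S N v = (\<integral>\<^sup>+x. u x \<partial>N) + (\<integral>\<^sup>+x. v x \<partial>N)"
      using that by (simp add: nn_integral_eq_simple_integral)
    also have "\<dots> = (\<integral>\<^sup>+x. u x + v x \<partial>N)"
      using that by (subst nn_integral_add) (auto intro: borel_measurable_simple_function)
    also have "\<dots> \<le> (\<integral>\<^sup>+x. f x + g x \<partial>N)"
      using that by (intro nn_integral_mono add_mono) (auto simp: le_fun_def)
    finally show ?thesis .
  qed
  have "(\<integral>\<^sup>+x. f x \<partial>N) + (\<integral>\<^sup>+x. g x \<partial>N) =
     (SUP v\<in>?S g. SUP u\<in>?S f. integral\<^sup>S N u + integral\<^sup>S N v)"
    unfolding nn_integral_def ennreal_SUP_add_left[OF ne, symmetric] ennreal_SUP_add_right[OF ne] ..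
  also have "\<dots> \<le> (\<integral>\<^sup>+x. f x + g x \<partial>N)"
    using * by (intro SUP_least) auto
  finally show ?thesis .
qed

lemma nn_integral_sum_le:
  "(\<Sum>i\<in>I. \<integral>\<^sup>+x. f i x \<partial>N) \<le> (\<integral>\<^sup>+x. (\<Sum>i\<in>I. f i x) \<partial>N)"
proof (induction I rule: infinite_finite_induct)
  case (insert i I)
  then show ?case
    using nn_integral_superadditive[of N "f i" "\<lambda>x. \<Sum>i\<in>I. f i x"]
    by (auto intro: order_trans add_left_mono)
qed auto

section \<open>Sign flips and leave-one-out thresholds\<close>

definition flip :: "'a set \<Rightarrow> ('a \<Rightarrow> real) \<Rightarrow> 'a \<Rightarrow> real" where
  "flip S w = (\<lambda>j. if j \<in> S then - w j else w j)"

lemma threshold_candidates_finite: "finite (threshold_candidates a q w)"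
  by (simp add: threshold_candidates_def)

lemma knockoff_threshold_le_iff:
  "knockoff_threshold a q w \<le> ereal x \<longleftrightarrow> (\<exists>t\<in>threshold_candidates a q w. t \<le> x)"
  using Min_le_iff[OF threshold_candidates_finite, of a q w x]
  by (auto simp: knockoff_threshold_def)

text \<open>Candidates are nonzero absolute values, so a finite threshold is positive; a coordinate
  and its negative therefore cannot both reach it.\<close>

lemma knockoff_threshold_in:
  assumes "knockoff_threshold a q w \<le> ereal x"
  obtains t where "t \<in> threshold_candidates a q w" "knockoff_threshold a q w = ereal t" "0 < t" "t \<le> x"
proof -
  have "threshold_candidates a q w \<noteq> {}"
    using assms by (auto simp: knockoff_threshold_le_iff)
  moreover from this have "Min (threshold_candidates a q w) \<in> threshold_candidates a q w"
    by (intro Min_in threshold_candidates_finite)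
  moreover have "t > 0" if "t \<in> threshold_candidates a q w" for t
    using that by (auto simp: threshold_candidates_def)
  ultimately show thesis
    using assms by (intro that) (auto simp: knockoff_threshold_def)
qed

text \<open>It ignores the sign of \<open>w j\<close>, yet agrees with the actual threshold for
  \<open>0 \<le> w j\<close>, in particular whenever \<open>j\<close> is selected.\<close>

definition loo_threshold :: "nat \<Rightarrow> real \<Rightarrow> ('a::finite \<Rightarrow> real) \<Rightarrow> 'a \<Rightarrow> ereal" where
  "loo_threshold a q w j = knockoff_threshold a q (w(j := \<bar>w j\<bar>))"

lemma loo_threshold_eq: "0 \<le> w j \<Longrightarrow> loo_threshold a q w j = knockoff_threshold a q w"
  by (simp add: loo_threshold_def)

lemma loo_threshold_flip: "loo_threshold a q (flip {j} w) j = loo_threshold a q w j"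
proof -
  have "(flip {j} w)(j := \<bar>flip {j} w j\<bar>) = w(j := \<bar>w j\<bar>)"
    by (auto simp: flip_def)
  then show ?thesis by (simp add: loo_threshold_def)
qed

text \<open>Let t be the threshold of \<open>j\<close>, the smaller one. Both \<open>w j\<close> and
  \<open>w k\<close> are at most \<open>- t\<close>, so taking the absolute value of either one
  moves one index from the lower count to the upper. The counts at \<open>t\<close> agree, hence
  \<open>t\<close> is a candidate for \<open>k\<close> as well.\<close>

lemma loo_threshold_eqI:
  assumes le: "loo_threshold a q w j \<le> loo_threshold a q w k"
    and j: "loo_threshold a q w j \<le> ereal (- w j)" and k: "loo_threshold a q w k \<le> ereal (- w k)"
  shows "loo_threshold a q w k = loo_threshold a q w j"
proof -
  from j obtain t where t: "t \<in> threshold_candidates a q (w(j := \<bar>w j\<bar>))"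
    "loo_threshold a q w j = ereal t" "0 < t"
    unfolding loo_threshold_def by (rule knockoff_threshold_in)
  have tj: "w j \<le> - t" using j t by simp
  have "ereal t \<le> ereal (- w k)" using le k t(2) by (metis order_trans)
  then have tk: "w k \<le> - t" by simp
  have count: "{i. (w(l := \<bar>w l\<bar>)) i \<le> - t} = {i. w i \<le> - t} - {l}"
    "{i. t \<le> (w(l := \<bar>w l\<bar>)) i} = insert l {i. t \<le> w i}" if "w l \<le> - t" for l
    using that \<open>0 < t\<close> by (auto split: if_splits)
  have "card {i. (w(k := \<bar>w k\<bar>)) i \<le> - t} = card {i. (w(j := \<bar>w j\<bar>)) i \<le> - t}"
    "card {i. t \<le> (w(k := \<bar>w k\<bar>)) i} = card {i. t \<le> (w(j := \<bar>w j\<bar>)) i}"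
    unfolding count[OF tj] count[OF tk] using tj tk \<open>0 < t\<close> by (auto simp: card_insert_if)
  moreover have "range (\<lambda>i. \<bar>(w(k := \<bar>w k\<bar>)) i\<bar>) = range (\<lambda>i. \<bar>(w(j := \<bar>w j\<bar>)) i\<bar>)"
    by (intro image_cong) auto
  ultimately have "t \<in> threshold_candidates a q (w(k := \<bar>w k\<bar>))"
    using t(1) unfolding threshold_candidates_def by (simp del: fun_upd_apply)
  then have "loo_threshold a q w k \<le> ereal t"
    unfolding loo_threshold_def by (auto simp: knockoff_threshold_le_iff)
  with t(2) le show ?thesis by simp
qed

text \<open>Symmetric difference with \<open>{j}\<close> is an involution of \<open>Pow H\<close>,
  and on the sign patterns it flips coordinate \<open>j\<close>.\<close>

lemma sum_Pow_flip:
  fixes g :: "('a \<Rightarrow> real) \<Rightarrow> real"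
  assumes "j \<in> H"
  shows "(\<Sum>S\<in>Pow H. g (flip S w)) = (\<Sum>S\<in>Pow H. g (flip {j} (flip S w)))"
proof (rule sum.reindex_bij_witness[of _ "\<lambda>S. sym_diff S {j}" "\<lambda>S. sym_diff S {j}"])
  fix S
  have "flip {j} (flip (sym_diff S {j}) w) = flip S w"
    by (auto simp: flip_def)
  then show "g (flip {j} (flip (sym_diff S {j}) w)) = g (flip S w)"
    by simp
qed (use assms in auto)

text \<open>The nonzero summands belong to \<open>J\<close>, on which all thresholds coincide by
  \<open>loo_threshold_eqI\<close>. Hence each of the \<open>card J\<close> summands has a
  denominator of at least \<open>card J\<close>.\<close>

lemma sum_null_ratio_le_1:
  fixes w :: "'a::finite \<Rightarrow> real"
  shows "(\<Sum>j\<in>H. of_bool (loo_threshold a q w j \<le> ereal (- w j)) /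
     real (card {k\<in>H. loo_threshold a q w j \<le> ereal (- w k)})) \<le> 1"
proof -
  let ?T = "loo_threshold a q w"
  define J where "J = {j\<in>H. ?T j \<le> ereal (- w j)}"
  have "(\<Sum>j\<in>H. of_bool (?T j \<le> ereal (- w j)) / real (card {k\<in>H. ?T j \<le> ereal (- w k)}))
      = (\<Sum>j\<in>J. 1 / real (card {k\<in>H. ?T j \<le> ereal (- w k)}))"
    by (intro sum.mono_neutral_cong_right) (auto simp: J_def)
  also have "\<dots> \<le> (\<Sum>j\<in>J. 1 / real (card J))"
  proof (intro sum_mono)
    fix j assume j: "j \<in> J"
    have "?T k = ?T j" if "k \<in> J" for k
      using loo_threshold_eqI[of a q w j k] loo_threshold_eqI[of a q w k j] that j
      by (auto simp: J_def dest: linear[of "?T j" "?T k", THEN disjE])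
    then have "J \<subseteq> {k\<in>H. ?T j \<le> ereal (- w k)}"
      by (force simp: J_def)
    then have "card J \<le> card {k\<in>H. ?T j \<le> ereal (- w k)}"
      by (intro card_mono) auto
    moreover have "0 < card J" using j by (auto simp: card_gt_0_iff)
    ultimately show "1 / real (card {k\<in>H. ?T j \<le> ereal (- w k)}) \<le> 1 / real (card J)"
      by (intro divide_left_mono) auto
  qed
  also have "\<dots> \<le> 1" by simp
  finally show ?thesis .
qed

text \<open>This is V+ / (1 + V-) for the numbers of nulls at or beyond the threshold on the
  positive and the negative side; it is 0 when the threshold is infinite.\<close>

definition null_ratio :: "nat \<Rightarrow> real \<Rightarrow> 'a set \<Rightarrow> ('a::finite \<Rightarrow> real) \<Rightarrow> real" where
  "null_ratio a q H w =
     real (card {j\<in>H. knockoff_threshold a q w \<le> ereal (w j)}) /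
     (1 + real (card {j\<in>H. knockoff_threshold a q w \<le> ereal (- w j)}))"

text \<open>A summand survives only if \<open>w j\<close> reaches the threshold. Then
  \<open>w j > 0\<close>, so the threshold is the leave-one-out one and \<open>j\<close> is not
  among the negative indices. Excluding \<open>j\<close> there makes the denominator independent of
  the sign of \<open>w j\<close>.\<close>

lemma null_ratio_eq:
  fixes w :: "'a::finite \<Rightarrow> real"
  shows "null_ratio a q H w = (\<Sum>j\<in>H. of_bool (loo_threshold a q w j \<le> ereal (w j)) /
     (1 + real (card {k\<in>H - {j}. loo_threshold a q w j \<le> ereal (- w k)})))"
proof -
  let ?T = "knockoff_threshold a q w"
  have "null_ratio a q H w =
      (\<Sum>j\<in>H. of_bool (?T \<le> ereal (w j)) / (1 + real (card {k\<in>H. ?T \<le> ereal (- w k)})))"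
    by (simp add: null_ratio_def flip: sum_divide_distrib)
      (simp add: of_bool_def sum.If_cases Int_def)
  also have "\<dots> = (\<Sum>j\<in>H. of_bool (loo_threshold a q w j \<le> ereal (w j)) /
     (1 + real (card {k\<in>H - {j}. loo_threshold a q w j \<le> ereal (- w k)})))"
  proof (rule sum.cong[OF refl])
    fix j assume "j \<in> H"
    show "of_bool (?T \<le> ereal (w j)) / (1 + real (card {k\<in>H. ?T \<le> ereal (- w k)})) =
      of_bool (loo_threshold a q w j \<le> ereal (w j)) /
      (1 + real (card {k\<in>H - {j}. loo_threshold a q w j \<le> ereal (- w k)}))"
    proof (cases "0 < w j")
      case True
      have "\<not> ?T \<le> ereal (- w j)"
        using True by (auto elim!: knockoff_threshold_in)
      then have "{k\<in>H - {j}. ?T \<le> ereal (- w k)} = {k\<in>H. ?T \<le> ereal (- w k)}"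
        by auto
      then show ?thesis
        using True by (simp add: loo_threshold_eq)
    next
      case False
      then have "\<not> ?T \<le> ereal (w j)" "\<not> loo_threshold a q w j \<le> ereal (w j)"
        unfolding loo_threshold_def by (auto elim!: knockoff_threshold_in)
      then show ?thesis by simp
    qed
  qed
  finally show ?thesis .
qed

text \<open>Exchanging the two sums isolates one index; reindexing by a flip of that index and
  exchanging back leaves, for each sign pattern, the sum bounded in
  \<open>sum_null_ratio_le_1\<close>.\<close>

lemma sum_null_ratio_le:
  fixes w :: "'a::finite \<Rightarrow> real"
  shows "(\<Sum>S\<in>Pow H. null_ratio a q H (flip S w)) \<le> 2 ^ card H"
proof -
  let ?g = "\<lambda>j w. of_bool (loo_threshold a q w j \<le> ereal (w j)) /
     (1 + real (card {k\<in>H - {j}. loo_threshold a q w j \<le> ereal (- w k)}))"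
  let ?h = "\<lambda>j w. of_bool (loo_threshold a q w j \<le> ereal (- w j)) /
     real (card {k\<in>H. loo_threshold a q w j \<le> ereal (- w k)})"
  \<comment> \<open>In the nonzero case of \<open>?h\<close>, \<open>j\<close> itself is in the
    counted set and accounts for the summand 1 in the denominator of \<open>?g\<close>.\<close>
  have gh: "?g j (flip {j} w) = ?h j w" if "j \<in> H" for j and w :: "'a \<Rightarrow> real"
  proof (cases "loo_threshold a q w j \<le> ereal (- w j)")
    case True
    have "{k\<in>H. loo_threshold a q w j \<le> ereal (- w k)} =
        insert j {k\<in>H - {j}. loo_threshold a q w j \<le> ereal (- flip {j} w k)}"
      using True that by (auto simp: flip_def)
    then show ?thesis
      using True by (simp add: loo_threshold_flip) (simp add: flip_def)
  qed (simp add: loo_threshold_flip, simp add: flip_def)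
  have "(\<Sum>S\<in>Pow H. null_ratio a q H (flip S w)) = (\<Sum>j\<in>H. \<Sum>S\<in>Pow H. ?g j (flip S w))"
    unfolding null_ratio_eq by (rule sum.swap)
  also have "\<dots> = (\<Sum>j\<in>H. \<Sum>S\<in>Pow H. ?h j (flip S w))"
  proof (rule sum.cong[OF refl])
    fix j assume "j \<in> H"
    then have "(\<Sum>S\<in>Pow H. ?g j (flip S w)) = (\<Sum>S\<in>Pow H. ?g j (flip {j} (flip S w)))"
      by (rule sum_Pow_flip)
    then show "(\<Sum>S\<in>Pow H. ?g j (flip S w)) = (\<Sum>S\<in>Pow H. ?h j (flip S w))"
      unfolding gh[OF \<open>j \<in> H\<close>] .
  qed
  also have "\<dots> = (\<Sum>S\<in>Pow H. \<Sum>j\<in>H. ?h j (flip S w))"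
    by (rule sum.swap)
  also have "\<dots> \<le> (\<Sum>S\<in>Pow H. 1)"
    by (intro sum_mono sum_null_ratio_le_1)
  also have "\<dots> = 2 ^ card H"
    by (simp add: card_Pow)
  finally show ?thesis .
qed

section \<open>Bounds for the error proportions by the null ratio\<close>

lemma fdp_le:
  fixes w :: "'a::finite \<Rightarrow> real"
  assumes "0 \<le> q" "1 \<le> a"
  shows "fdp H (knockoff_selected a q w) \<le> ennreal (q * null_ratio a q H w)"
proof -
  let ?T = "knockoff_threshold a q w" and ?S = "knockoff_selected a q w"
  let ?V = "{j\<in>H. ?T \<le> ereal (- w j)}"
  show ?thesis
  proof (cases "H \<inter> ?S = {}")
    case False
    then obtain j where j: "j \<in> H" "?T \<le> ereal (w j)"
      by (auto simp: knockoff_selected_def)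
    then obtain t where t: "t \<in> threshold_candidates a q w" "?T = ereal t" "0 < t"
      by (auto elim: knockoff_threshold_in)
    have S: "?S = {j. t \<le> w j}"
      by (simp add: knockoff_selected_def t)
    have "?S \<noteq> {}" using False by auto
    then have S0: "0 < card ?S" by (simp add: card_gt_0_iff)
    have "(real a + real (card {j. w j \<le> - t})) / real (card ?S) \<le> q"
      using t(1) S0 by (simp add: threshold_candidates_def S)
    moreover have "card ?V \<le> card {j. w j \<le> - t}"
      by (intro card_mono) (auto simp: t)
    \<comment> \<open>The selected set is nonempty, so the maximum with 1 in the candidate condition
      is \<open>card ?S\<close>; the offset \<open>a\<close> supplies the summand 1.\<close>
    ultimately have V: "1 + real (card ?V) \<le> q * real (card ?S)"
      using S0 \<open>1 \<le> a\<close> by (simp add: divide_simps)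
    have "real (card (H \<inter> ?S)) / real (card ?S) \<le> q * (real (card (H \<inter> ?S)) / (1 + real (card ?V)))"
      using mult_right_mono[OF V, of "real (card (H \<inter> ?S))"] S0
      by (simp add: divide_simps mult_ac)
    also have "H \<inter> ?S = {j\<in>H. ?T \<le> ereal (w j)}"
      by (auto simp: knockoff_selected_def)
    finally have "real (card (H \<inter> ?S)) / real (card ?S) \<le> q * null_ratio a q H w"
      by (simp add: null_ratio_def knockoff_selected_def Int_def)
    moreover have "fdp H ?S = ennreal (real (card (H \<inter> ?S)) / real (card ?S))"
      using S0 by (simp add: fdp_def divide_ennreal ennreal_of_nat_eq_real_of_nat)
    ultimately show ?thesis
      using ennreal_leI by metis
  qed (simp add: fdp_def)
qed

lemma mfdp_le:
  fixes w :: "'a::finite \<Rightarrow> real"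
  assumes q: "0 \<le> q"
  shows "mfdp q H (knockoff_selected a q w) \<le> ennreal (q * null_ratio a q H w)"
proof -
  let ?T = "knockoff_threshold a q w" and ?S = "knockoff_selected a q w"
  let ?V = "{j\<in>H. ?T \<le> ereal (- w j)}"
  show ?thesis
  proof (cases "H \<inter> ?S = {} \<or> q = 0")
    case False
    then obtain j where j: "j \<in> H" "?T \<le> ereal (w j)"
      by (auto simp: knockoff_selected_def)
    then obtain t where t: "t \<in> threshold_candidates a q w" "?T = ereal t" "0 < t"
      by (auto elim: knockoff_threshold_in)
    have q0: "0 < q" using False q by simp
    have S: "?S = {j. t \<le> w j}"
      by (simp add: knockoff_selected_def t)
    have "?S \<noteq> {}" using False by auto
    then have S0: "0 < card ?S" by (simp add: card_gt_0_iff)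
    have "(real a + real (card {j. w j \<le> - t})) / real (card ?S) \<le> q"
      using t(1) S0 by (simp add: threshold_candidates_def S)
    moreover have "card ?V \<le> card {j. w j \<le> - t}"
      by (intro card_mono) (auto simp: t)
    \<comment> \<open>Here the summand 1 is \<open>q * inverse q\<close> and comes from the modified
      denominator instead of \<open>a\<close>, which is why \<open>q = 0\<close> is split
      off.\<close>
    ultimately have V: "1 + real (card ?V) \<le> q * (real (card ?S) + inverse q)"
      using S0 q0 by (simp add: divide_simps algebra_simps)
    have p: "0 < real (card ?S) + inverse q" using q0 by (simp add: add_nonneg_pos)
    have "real (card (H \<inter> ?S)) / (real (card ?S) + inverse q) \<le> q * (real (card (H \<inter> ?S)) / (1 + real (card ?V)))"
    proof -
      have "real (card (H \<inter> ?S)) * (1 + real (card ?V)) \<le> q * real (card (H \<inter> ?S)) * (real (card ?S) + inverse q)"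
        using mult_right_mono[OF V, of "real (card (H \<inter> ?S))"] by (simp add: mult_ac)
      then show ?thesis
        using p by (simp add: pos_divide_le_eq pos_le_divide_eq add_pos_nonneg)
    qed
    also have "H \<inter> ?S = {j\<in>H. ?T \<le> ereal (w j)}"
      by (auto simp: knockoff_selected_def)
    finally have "real (card (H \<inter> ?S)) / (real (card ?S) + inverse q) \<le> q * null_ratio a q H w"
      by (simp add: null_ratio_def knockoff_selected_def Int_def)
    moreover have "mfdp q H ?S = ennreal (real (card (H \<inter> ?S)) / (real (card ?S) + inverse q))"
      using p q0
      by (simp add: mfdp_def ennreal_of_nat_eq_real_of_nat inverse_ennreal divide_ennreal flip: ennreal_plus)
    ultimately show ?thesis
      using ennreal_leI by metis
  qed (auto simp: mfdp_def mfdp_0)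
qed

section \<open>Equivariance of the solution paths\<close>

definition relabel :: "('k \<Rightarrow> 'k) \<Rightarrow> real ^ 'k \<Rightarrow> real ^ 'k" where
  "relabel \<pi> g = (\<chi> k. g $ \<pi> k)"

lemma relabel_nth [simp]: "relabel \<pi> g $ k = g $ \<pi> k"
  by (simp add: relabel_def)

lemma relabel_0 [simp]: "relabel \<pi> 0 = 0"
  by (simp add: vec_eq_iff)

lemma linear_relabel: "linear (relabel \<pi>)"
  by (intro linearI) (auto simp: vec_eq_iff)

lemma bounded_linear_relabel: "bounded_linear (relabel \<pi>)"
  using linear_relabel linear_conv_bounded_linear by blast

lemma shrink_relabel: "shrink (relabel \<pi> w) = relabel \<pi> (shrink w)"
  by (simp add: shrink_def vec_eq_iff)

text \<open>\<open>R\<close> permutes the columns of \<open>X\<close> along \<open>\<pi>\<close> and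
  fixes the range of \<open>D\<close>. For each path, relabelling a solution for \<open>y\<close>
  then gives a solution for \<open>R y\<close> with the same unpenalized part.\<close>

locale equivariance =
  fixes D :: "real ^ 'v::finite ^ 'e::finite" and X :: "real ^ 'k::finite ^ 'e"
    and R :: "real ^ 'e \<Rightarrow> real ^ 'e" and \<pi> :: "'k \<Rightarrow> 'k"
  assumes linear_R: "linear R"
    and R_R: "\<And>x. R (R x) = x"
    and inner_R: "\<And>x y. R x \<bullet> R y = x \<bullet> y"
    and R_D: "\<And>\<theta>. R (D *v \<theta>) = D *v \<theta>"
    and R_X: "\<And>g. R (X *v g) = X *v relabel \<pi> g"
    and \<pi>_\<pi>: "\<And>k. \<pi> (\<pi> k) = k"
begin

lemma relabel_relabel [simp]: "relabel \<pi> (relabel \<pi> g) = g"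
  by (simp add: vec_eq_iff \<pi>_\<pi>)

lemma norm_R: "norm (R x) = norm x"
  by (simp add: norm_eq_sqrt_inner inner_R)

lemma inner_R_left: "R x \<bullet> y = x \<bullet> R y"
  by (metis inner_R R_R)

lemma inner_relabel: "relabel \<pi> g \<bullet> h = g \<bullet> relabel \<pi> h"
  unfolding inner_vec_def
  by (rule sum.reindex_bij_witness[of _ \<pi> \<pi>]) (auto simp: \<pi>_\<pi>)

lemma l1norm_relabel: "l1norm (relabel \<pi> g) = l1norm g"
  unfolding l1norm_def
  by (rule sum.reindex_bij_witness[of _ \<pi> \<pi>]) (auto simp: \<pi>_\<pi>)

lemma residual_R: "residual D X (R y) \<theta> (relabel \<pi> g) = R (residual D X y \<theta> g)"
  by (simp add: residual_def linear_diff[OF linear_R] R_D R_X)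

text \<open>\<open>r v* D\<close> is \<open>transpose D *v r\<close>, as in the path equations.
  \<open>R\<close> is its own adjoint, so it can be moved to the range of \<open>D\<close>, where it
  is the identity; on the range of \<open>X\<close> it becomes the self-adjoint map
  \<open>relabel \<pi>\<close>.\<close>

lemma R_mult_D: "R r v* D = r v* D"
  by (rule vector_eq_rdot[THEN iffD1]) (auto simp: dot_lmul_matrix inner_R_left R_D)

lemma R_mult_X: "R r v* X = relabel \<pi> (r v* X)"
  by (rule vector_eq_rdot[THEN iffD1]) (auto simp: dot_lmul_matrix inner_R_left R_X inner_relabel)

lemma lasso_solution_R:
  assumes "lasso_solution D X y l \<theta> g"
  shows "lasso_solution D X (R y) l \<theta> (relabel \<pi> g)"
proof -
  let ?F = "\<lambda>y (\<theta>, g). 1/2 * (norm (residual D X y \<theta> g))\<^sup>2 + l * l1norm g"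
  have F: "?F (R y) (\<theta>, relabel \<pi> g) = ?F y (\<theta>, g)" for \<theta> g
    by (simp add: residual_R norm_R l1norm_relabel)
  have "?F y (\<theta>, g) \<le> ?F y (\<theta>', relabel \<pi> g')" for \<theta>' g'
    using assms by (auto simp: lasso_solution_def is_arg_min_linorder)
  then have "?F (R y) (\<theta>, relabel \<pi> g) \<le> ?F (R y) (\<theta>', g')" for \<theta>' g'
    using F[of \<theta> g] F[of \<theta>' "relabel \<pi> g'"] by simp
  then show ?thesis
    by (auto simp: lasso_solution_def is_arg_min_linorder)
qed

lemma subdifferential_l1norm_relabel:
  assumes "p \<in> subdifferential l1norm g"
  shows "relabel \<pi> p \<in> subdifferential l1norm (relabel \<pi> g)"
proof -
  have "l1norm (relabel \<pi> z) \<ge> l1norm g + p \<bullet> (relabel \<pi> z - g)" for z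
    using assms by (auto simp: subdifferential_def)
  moreover have "relabel \<pi> p \<bullet> (z - relabel \<pi> g) = p \<bullet> (relabel \<pi> z - g)" for z
    by (simp add: inner_relabel linear_diff[OF linear_relabel])
  ultimately show ?thesis
    by (simp add: subdifferential_def l1norm_relabel)
qed

lemma iss_solution_R:
  assumes "iss_solution D X y p \<theta> g"
  shows "iss_solution D X (R y) (\<lambda>t. relabel \<pi> (p t)) \<theta> (\<lambda>t. relabel \<pi> (g t))"
  using assms unfolding iss_solution_def
  by (auto simp: residual_R R_mult_D R_mult_X subdifferential_l1norm_relabel
      intro!: bounded_linear.continuous_on[OF bounded_linear_relabel]
        bounded_linear.continuous[OF bounded_linear_relabel]
        bounded_linear.has_vector_derivative[OF bounded_linear_relabel])

text \<open>The data enter the start only through \<open>transpose D *v y\<close>, which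
  \<open>R\<close> does not change; each step commutes with relabelling, as \<open>shrink\<close>
  acts coordinatewise.\<close>

lemma lbi_state_R:
  "lbi_state D X (R y) \<kappa> dt n =
     (case lbi_state D X y \<kappa> dt n of (w, \<theta>, g) \<Rightarrow> (relabel \<pi> w, \<theta>, relabel \<pi> g))"
  by (induction n)
    (auto simp: residual_R R_mult_D R_mult_X Let_def
      linear_add[OF linear_relabel] linear_cmul[OF linear_relabel]
      simp flip: shrink_relabel split: prod.splits)

lemma lbi_path_R: "lbi_path D X (R y) \<kappa> dt n = relabel \<pi> (lbi_path D X y \<kappa> dt n)"
  by (simp add: lbi_path_def lbi_state_R split: prod.splits)

lemma entry_set_R_subset: "entry_set m D X y (\<pi> k) \<subseteq> entry_set m D X (R y) k"
proof (cases m)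
  case ISS
  show ?thesis
  proof
    fix x assume "x \<in> entry_set m D X y (\<pi> k)"
    then obtain t p \<theta> g where "x = 1 / t" "t > 0" and s: "iss_solution D X y p \<theta> g" and "g t $ \<pi> k \<noteq> 0"
      by (auto simp: ISS)
    then have "\<exists>p \<theta> g. iss_solution D X (R y) p \<theta> g \<and> g t $ k \<noteq> 0"
      using iss_solution_R[OF s] by (intro exI conjI) auto
    then show "x \<in> entry_set m D X (R y) k"
      using \<open>x = 1 / t\<close> \<open>t > 0\<close> by (auto simp: ISS)
  qed
next
  case (LBI \<kappa> dt tstop)
  then show ?thesis by (auto simp: lbi_path_R)
next
  case LASSO
  show ?thesis
  proof
    fix l assume "l \<in> entry_set m D X y (\<pi> k)"
    then obtain \<theta> g where "l > 0" and s: "lasso_solution D X y l \<theta> g" and "g $ \<pi> k \<noteq> 0"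
      by (auto simp: LASSO)
    then have "\<exists>\<theta> g. lasso_solution D X (R y) l \<theta> g \<and> g $ k \<noteq> 0"
      using lasso_solution_R[OF s] by (intro exI conjI) auto
    then show "l \<in> entry_set m D X (R y) k"
      using \<open>l > 0\<close> by (auto simp: LASSO)
  qed
qed

lemma entry_set_R: "entry_set m D X (R y) k = entry_set m D X y (\<pi> k)"
  using entry_set_R_subset[of m y k] entry_set_R_subset[of m "R y" "\<pi> k"]
  by (auto simp: R_R \<pi>_\<pi>)

lemma Z_stat_R: "Z_stat m D X (R y) k = Z_stat m D X y (\<pi> k)"
  by (simp add: Z_stat_def entry_set_R)

end

section \<open>Reflections exchanging a feature with its knockoff\<close>

definition reflect :: "'b::real_inner \<Rightarrow> 'b \<Rightarrow> 'b" where
  "reflect v x = x - (2 * (v \<bullet> x) / (v \<bullet> v)) *\<^sub>R v"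

lemma linear_reflect: "linear (reflect v)"
  by (intro linearI) (auto simp: reflect_def algebra_simps add_divide_distrib)

lemma reflect_reflect: "reflect v (reflect v x) = x"
  by (cases "v = 0") (simp_all add: reflect_def algebra_simps)

lemma inner_reflect: "reflect v x \<bullet> reflect v y = x \<bullet> y"
  by (cases "v = 0") (simp_all add: reflect_def algebra_simps inner_commute)

lemma reflect_orthogonal: "v \<bullet> x = 0 \<Longrightarrow> reflect v x = x"
  by (simp add: reflect_def)

lemma inner_column:
  fixes A :: "real ^ 'n ^ 'm" and B :: "real ^ 'k ^ 'm"
  shows "column i A \<bullet> column j B = (transpose A ** B) $ i $ j"
  by (simp add: column_def inner_vec_def matrix_matrix_mult_def transpose_def)

definition swap_pair :: "'a \<Rightarrow> 'a + 'a \<Rightarrow> 'a + 'a" where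
  "swap_pair j k = (if k = Inl j then Inr j else if k = Inr j then Inl j else k)"

lemma column_augment:
  "column (Inl i) (augment A B) = column i A" "column (Inr i) (augment A B) = column i B"
  by (simp_all add: column_def augment_def vec_eq_iff)

locale knockoff =
  fixes D :: "real ^ 'v::finite ^ 'e::finite" and A At :: "real ^ 'a::finite ^ 'e" and s :: "real ^ 'a"
  assumes s_pos: "\<And>j. s $ j > 0"
    and tAt_At: "transpose At ** At = transpose A ** A"
    and tA_At: "transpose A ** At = transpose A ** A - diag_mat s"
    and tD_At: "transpose D ** At = transpose D ** A"
begin

definition dir :: "'a \<Rightarrow> real ^ 'e" where
  "dir j = column j A - column j At"

abbreviation swap :: "'a \<Rightarrow> real ^ 'e \<Rightarrow> real ^ 'e" where
  "swap j \<equiv> reflect (dir j)"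

lemma inner_A_At: "column i A \<bullet> column j At = column i A \<bullet> column j A - (if i = j then s $ i else 0)"
  by (simp add: inner_column tA_At diag_mat_def)

lemma inner_At_At: "column i At \<bullet> column j At = column i A \<bullet> column j A"
  by (simp add: inner_column tAt_At)

lemma dir_A: "dir j \<bullet> column i A = (if i = j then s $ j else 0)"
  using inner_A_At[of i j] by (simp add: dir_def inner_diff_left inner_diff_right inner_commute)

lemma dir_At: "dir j \<bullet> column i At = (if i = j then - s $ j else 0)"
  using inner_A_At[of j i] by (simp add: dir_def inner_diff_left inner_At_At)

lemma dir_dir: "dir j \<bullet> dir j = 2 * s $ j"
  using dir_A[of j j] dir_At[of j j] unfolding dir_def by (simp add: inner_diff_right)

lemma dir_D_column: "dir j \<bullet> column i D = 0"
  using arg_cong[OF tD_At, of "\<lambda>M. M $ i $ j"]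
  by (simp add: dir_def inner_diff_left inner_diff_right inner_commute flip: inner_column)

lemma dir_D: "dir j \<bullet> (D *v \<theta>) = 0"
  by (simp add: matrix_mult_sum scalar_mult_eq_scaleR inner_sum_right dir_D_column)

text \<open>Links the nulls to the reflections: together with \<open>dir_D\<close>, the mean of the
  data is orthogonal to \<open>dir j\<close> when \<open>\<gamma> $ j = 0\<close>.\<close>

lemma dir_A_mult: "dir j \<bullet> (A *v g) = s $ j * g $ j"
  by (simp add: matrix_mult_sum scalar_mult_eq_scaleR inner_sum_right dir_A if_distrib[of "(*) _"] mult.commute[of "s $ j"] cong: if_cong)

text \<open>As \<open>dir j\<close> has squared norm \<open>2 * s $ j\<close>, the reflection
  coefficient is 1 on column \<open>j\<close> of \<open>A\<close> and -1 on column \<open>j\<close>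
  of \<open>At\<close>, so \<open>dir j\<close> is subtracted or added once; all other columns are
  orthogonal to it.\<close>

lemma swap_column: "swap j (column k (augment A At)) = column (swap_pair j k) (augment A At)"
proof (cases k)
  case (Inl i)
  then show ?thesis
    using s_pos[of j] by (auto simp: column_augment swap_pair_def reflect_def dir_A dir_dir) (simp add: dir_def)
next
  case (Inr i)
  then show ?thesis
    using s_pos[of j] by (auto simp: column_augment swap_pair_def reflect_def dir_At dir_dir) (simp add: dir_def)
qed

lemma swap_augment:
  "swap j (augment A At *v g) = augment A At *v relabel (swap_pair j) g"
proof -
  have "swap j (augment A At *v g) = (\<Sum>k\<in>UNIV. g $ k *s column (swap_pair j k) (augment A At))"
    by (simp add: matrix_mult_sum linear_sum[OF linear_reflect] scalar_mult_eq_scaleR linear_cmul[OF linear_reflect] swap_column)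
  also have "\<dots> = (\<Sum>k\<in>UNIV. relabel (swap_pair j) g $ k *s column k (augment A At))"
    by (rule sum.reindex_bij_witness[of _ "swap_pair j" "swap_pair j"]) (auto simp: swap_pair_def)
  finally show ?thesis by (simp add: matrix_mult_sum)
qed

sublocale equivariance D "augment A At" "swap j" "swap_pair j" for j
  by (rule equivariance.intro)
    (auto simp: linear_reflect reflect_reflect inner_reflect swap_augment reflect_orthogonal[OF dir_D] swap_pair_def)

text \<open>The reflection exchanges the values of \<open>Z_stat\<close> at \<open>Inl j\<close> and
  \<open>Inr j\<close>. Their maximum is symmetric and the sign of their difference is odd.\<close>

lemma W_stat_swap:
  "W_stat m D A At (swap j y) i = (if i = j then - W_stat m D A At y i else W_stat m D A At y i)"
proof (cases "i = j")
  case True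
  then show ?thesis
    using sgn_minus[of "Z_stat m D (augment A At) y (Inl j) - Z_stat m D (augment A At) y (Inr j)"]
    by (simp add: W_stat_def Let_def Z_stat_R swap_pair_def max.commute del: sgn_minus)
next
  case False
  then show ?thesis
    by (simp add: W_stat_def Let_def Z_stat_R swap_pair_def)
qed

section \<open>Averaging over the sign flips of the null statistics\<close>

lemma exists_flip:
  assumes N: "sets N = sets borel" and inv: "\<And>j. j \<in> H \<Longrightarrow> distr N borel (swap j) = N"
  obtains R where "R \<in> borel_measurable borel" "distr N borel R = N"
    "\<And>y. W_stat m D A At (R y) = flip H (W_stat m D A At y)"
proof -
  have "finite H" by simp
  then have "\<exists>R \<in> borel_measurable borel. distr N borel R = N \<and>
      (\<forall>y. W_stat m D A At (R y) = flip H (W_stat m D A At y))"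
    using inv
  proof (induction H rule: finite_induct)
    case empty
    have "distr N borel (\<lambda>y. y) = N"
      using distr_id2[OF N[symmetric]] by (simp add: id_def)
    then show ?case
      by (intro bexI[of _ "\<lambda>y. y"]) (auto simp: flip_def)
  next
    case (insert j H)
    then obtain R where R [measurable]: "R \<in> borel_measurable borel" and RN: "distr N borel R = N"
      and W: "\<And>y. W_stat m D A At (R y) = flip H (W_stat m D A At y)"
      by auto
    have [measurable]: "swap j \<in> borel_measurable borel"
      using linear_reflect linear_conv_bounded_linear
      by (blast intro: borel_measurable_continuous_onI linear_continuous_on)
    have "distr (distr N borel R) borel (swap j) = distr N borel (\<lambda>y. swap j (R y))"
      by (subst distr_distr) (auto simp: comp_def measurable_cong_sets[OF N refl])
    then have "distr N borel (\<lambda>y. swap j (R y)) = N"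
      using insert.prems[of j] by (simp add: RN)
    \<comment> \<open>Since \<open>j\<close> is not in \<open>H\<close>, the outer reflection flips
      a coordinate that \<open>R\<close> left unchanged.\<close>
    moreover have "W_stat m D A At (swap j (R y)) = flip (insert j H) (W_stat m D A At y)" for y
      using \<open>j \<notin> H\<close> by (auto simp: fun_eq_iff W_stat_swap W flip_def)
    ultimately show ?case
      by (intro bexI[of _ "\<lambda>y. swap j (R y)"]) auto
  qed
  then show thesis using that by blast
qed

text \<open>Each sign pattern is realized by a measure-preserving map of the data, so the integral
  is at most its average over the patterns. \<open>F\<close> is kept abstract so that one argument
  serves \<open>mfdp\<close> and \<open>fdp\<close>.\<close>

lemma nn_integral_null_ratio_le:
  assumes N: "prob_space N" "sets N = sets borel"
    and inv: "\<And>j. j \<in> H \<Longrightarrow> distr N borel (swap j) = N"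
    and q: "0 \<le> q" and F: "\<And>w. F w \<le> ennreal (q * null_ratio a q H w)"
  shows "(\<integral>\<^sup>+y. F (W_stat m D A At y) \<partial>N) \<le> ennreal q"
proof -
  interpret N: prob_space N by fact
  let ?W = "W_stat m D A At"
  have le: "(\<integral>\<^sup>+y. F (?W y) \<partial>N) \<le> (\<integral>\<^sup>+y. F (flip S (?W y)) \<partial>N)" if S: "S \<subseteq> H" for S
  proof -
    obtain R where R: "R \<in> borel_measurable borel" "distr N borel R = N"
      "\<And>y. ?W (R y) = flip S (?W y)"
      by (rule exists_flip[OF N(2), of S m]) (use inv S in auto)
    have "R \<in> measurable N N" "distr N N R = N"
      using R N(2) by (simp_all cong: measurable_cong_sets distr_cong)
    from nn_integral_le_of_distr_eq[OF this, of "\<lambda>y. F (?W y)"] show ?thesis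
      by (simp add: R(3))
  qed
  have "2 ^ card H * (\<integral>\<^sup>+y. F (?W y) \<partial>N) = (\<Sum>S\<in>Pow H. \<integral>\<^sup>+y. F (?W y) \<partial>N)"
    by (simp add: card_Pow)
  also have "\<dots> \<le> (\<Sum>S\<in>Pow H. \<integral>\<^sup>+y. F (flip S (?W y)) \<partial>N)"
    by (intro sum_mono le) auto
  also have "\<dots> \<le> (\<integral>\<^sup>+y. (\<Sum>S\<in>Pow H. F (flip S (?W y))) \<partial>N)"
    by (rule nn_integral_sum_le)
  also have "\<dots> \<le> (\<integral>\<^sup>+y. ennreal (2 ^ card H * q) \<partial>N)"
  proof (intro nn_integral_mono)
    fix y
    have "(\<Sum>S\<in>Pow H. F (flip S (?W y))) \<le> (\<Sum>S\<in>Pow H. ennreal (q * null_ratio a q H (flip S (?W y))))"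
      by (intro sum_mono F)
    also have "\<dots> = ennreal (q * (\<Sum>S\<in>Pow H. null_ratio a q H (flip S (?W y))))"
      using q by (subst sum_ennreal) (auto simp: null_ratio_def sum_distrib_left)
    also have "\<dots> \<le> ennreal (2 ^ card H * q)"
      using mult_left_mono[OF sum_null_ratio_le q] by (intro ennreal_leI) (simp add: mult.commute)
    finally show "(\<Sum>S\<in>Pow H. F (flip S (?W y))) \<le> ennreal (2 ^ card H * q)" .
  qed
  also have "\<dots> = 2 ^ card H * ennreal q"
    using q by (simp add: N.emeasure_space_1 ennreal_mult flip: ennreal_power)
  finally show ?thesis
    by (subst (asm) ennreal_mult_le_mult_iff) (simp_all add: power_eq_top_ennreal)
qed

end

theorem theorem1:
  fixes cmp :: "'e::finite \<Rightarrow> 'a::finite \<times> 'v::finite \<times> 'v"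
    and \<theta> :: "real ^ 'v" and \<gamma> :: "real ^ 'a" and \<sigma> q :: real
    and M :: "'w measure" and \<epsilon> :: "'e \<Rightarrow> 'w \<Rightarrow> real"
    and At :: "real ^ 'a ^ 'e" and m :: path_method
    and Y :: "'w \<Rightarrow> real ^ 'e" and W :: "real ^ 'e \<Rightarrow> 'a \<Rightarrow> real"
  assumes "inj cmp"
    and "CARD('e) \<ge> 2 * CARD('a) + CARD('v)"
    and "prob_space M"
    and "\<sigma> > 0"
    and "prob_space.indep_vars M (\<lambda>_. borel) \<epsilon> UNIV"
    and "\<And>e. distributed M lborel (\<epsilon> e) (\<lambda>x. ennreal (normal_density 0 \<sigma> x))"
    and "\<And>\<omega>. Y \<omega> = delta0 cmp *v \<theta> + annot cmp *v \<gamma> + (\<chi> e. \<epsilon> e \<omega>)"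
    and "knockoff_features (delta0 cmp) (annot cmp) At"
    and "valid_method m"
    and "\<And>y. W y = W_stat m (delta0 cmp) (annot cmp) At y"
    and "0 \<le> q" and "q \<le> 1"
  shows "(\<integral>\<^sup>+ y. mfdp q {j. \<gamma> $ j = 0} (knockoff_selected 0 q (W y)) \<partial>distr M borel Y) \<le> ennreal q \<and>
         (\<integral>\<^sup>+ y. fdp {j. \<gamma> $ j = 0} (knockoff_selected 1 q (W y)) \<partial>distr M borel Y) \<le> ennreal q"
proof -
  obtain s where "knockoff (delta0 cmp) (annot cmp) At s"
    using assms(8) by (auto simp: knockoff_features_def knockoff_def)
  then interpret knockoff "delta0 cmp" "annot cmp" At s .
  interpret M: prob_space M by fact
  let ?H = "{j. \<gamma> $ j = 0}" and ?N = "distr M borel Y"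
  have W: "W = W_stat m (delta0 cmp) (annot cmp) At"
    using assms(10) by auto
  have [measurable]: "\<epsilon> e \<in> borel_measurable M" for e
    using assms(6)[of e] by (auto simp: distributed_def)
  have Y_meas: "Y \<in> borel_measurable M"
    by (subst borel_measurable_euclidean_space) (auto simp: Basis_vec_def inner_axis assms(7))
  have N: "prob_space ?N" "sets ?N = sets borel"
    using Y_meas by (auto intro: M.prob_space_distr)
  have inv: "distr ?N borel (swap j) = ?N" if "j \<in> ?H" for j
  proof (rule distr_gaussian_isometry[OF assms(3-7)])
    have "dir j \<bullet> (delta0 cmp *v \<theta> + annot cmp *v \<gamma>) = 0"
      using that by (simp add: inner_add_right dir_D dir_A_mult)
    then show "swap j (delta0 cmp *v \<theta> + annot cmp *v \<gamma>) = delta0 cmp *v \<theta> + annot cmp *v \<gamma>"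
      by (rule reflect_orthogonal)
  qed (simp_all add: linear_reflect reflect_reflect norm_R)
  \<comment> \<open>\<open>order_refl\<close> supplies \<open>1 \<le> a\<close> for
    \<open>a = 1\<close>; the modified proportion is used with \<open>a = 0\<close>.\<close>
  show ?thesis
    unfolding W
    using nn_integral_null_ratio_le[OF N inv \<open>0 \<le> q\<close> mfdp_le[OF \<open>0 \<le> q\<close>]]
      nn_integral_null_ratio_le[OF N inv \<open>0 \<le> q\<close> fdp_le[OF \<open>0 \<le> q\<close> order_refl]]
    by blast
qed

end
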